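(* Let $\Gamma$ be a graph with at least two vertices of degree $|V(\Gamma)|-1$. Then $\Gamma$ admits a $P_4$-decomposition if, and only if, $|E(\Gamma)|\equiv 0\pmod 3$. If $|E(\Gamma)|\equiv 1\pmod 3$ (respectively $|E(\Gamma)|\equiv 2\pmod 3$), then the edge set of $\Gamma$ can be partitioned into the edge sets of a collection of subgraphs isomorphic to $P_4$ together with one remaining edge (respectively two remaining edges, which may or may not share a vertex).
   Context: Graphs are finite and simple; $V(\Gamma)$ and $E(\Gamma)$ denote the vertex set and the edge set of $\Gamma$. $P_4$ denotes the path with $4$ vertices and $3$ edges. A $P_4$-decomposition of a graph $\Gamma$ is a set of subgraphs of $\Gamma$, each isomorphic to $P_4$, whose edge sets partition $E(\Gamma)$.
   Formalization: The graph is additionally assumed not to have exactly three vertices, which excludes only the triangle K_3: it has two vertices of degree |V|-1 and 3 edges but contains no P_4, so the claim as stated fails for it. *)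

theory Defs
  imports "HOL-Library.Disjoint_Sets"
begin

type_synonym 'a sgraph = "'a set \<times> 'a set set"

abbreviation verts :: "'a sgraph \<Rightarrow> 'a set" where
  "verts \<equiv> fst"

abbreviation edges :: "'a sgraph \<Rightarrow> 'a set set" where
  "edges \<equiv> snd"

definition simple_graph :: "'a sgraph \<Rightarrow> bool" where
  "simple_graph G \<longleftrightarrow> finite (verts G) \<and> (\<forall>e\<in>edges G. e \<subseteq> verts G \<and> card e = 2)"

definition degree :: "'a sgraph \<Rightarrow> 'a \<Rightarrow> nat" where
  "degree G v = card {e \<in> edges G. v \<in> e}"

definition subgraph :: "'a sgraph \<Rightarrow> 'a sgraph \<Rightarrow> bool" where
  "subgraph H G \<longleftrightarrow> simple_graph H \<and> verts H \<subseteq> verts G \<and> edges H \<subseteq> edges G"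

definition graph_iso :: "'a sgraph \<Rightarrow> 'b sgraph \<Rightarrow> bool" where
  "graph_iso G H \<longleftrightarrow> (\<exists>f. bij_betw f (verts G) (verts H) \<and>
     (\<forall>u\<in>verts G. \<forall>v\<in>verts G. {u, v} \<in> edges G \<longleftrightarrow> {f u, f v} \<in> edges H))"

definition path_graph :: "nat \<Rightarrow> nat sgraph" where
  "path_graph n = ({..<n}, {{i, Suc i} | i. Suc i < n})"

definition P4_decomposition :: "'a sgraph \<Rightarrow> 'a sgraph set \<Rightarrow> bool" where
  "P4_decomposition G D \<longleftrightarrow>
     (\<forall>H\<in>D. subgraph H G \<and> graph_iso H (path_graph 4)) \<and>
     disjoint_family_on edges D \<and> (\<Union>H\<in>D. edges H) = edges G"

text \<open>The edge set of \<open>G\<close> is partitioned into the edge sets of the members of \<open>D\<close> and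
  the individual edges in \<open>R\<close>.\<close>

definition P4_decomposition_with_rest ::
    "'a sgraph \<Rightarrow> 'a sgraph set \<Rightarrow> 'a set set \<Rightarrow> bool" where
  "P4_decomposition_with_rest G D R \<longleftrightarrow>
     (\<forall>H\<in>D. subgraph H G \<and> graph_iso H (path_graph 4)) \<and>
     disjoint_family_on edges D \<and>
     (\<forall>H\<in>D. edges H \<inter> R = {}) \<and> (\<Union>H\<in>D. edges H) \<union> R = edges G"

text \<open>The triangle has three vertices of degree \<open>2\<close> and three edges, but no subgraph isomorphic to
  \<open>P\<^sub>4\<close>; this is why the case of three vertices has to be excluded from the theorem.\<close>

lemma triangle_no_P4_decomposition:
  fixes G :: "nat sgraph"
  defines "G \<equiv> ({0, 1, 2}, {{0, 1}, {0, 2}, {1, 2}})"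
  shows "simple_graph G"
    and "card {v \<in> verts G. degree G v = card (verts G) - 1} = 3"
    and "card (edges G) mod 3 = 0"
    and "\<not> (\<exists>D. P4_decomposition G D)"
proof -
  show "simple_graph G"
    by (simp add: G_def simple_graph_def)
  have "{e \<in> edges G. 0 \<in> e} = {{0, 1}, {0, 2}}"
       "{e \<in> edges G. 1 \<in> e} = {{0, 1}, {1, 2}}"
       "{e \<in> edges G. 2 \<in> e} = {{0, 2}, {1, 2}}"
    by (auto simp: G_def)
  then have "degree G 0 = 2" "degree G 1 = 2" "degree G 2 = 2"
    by (simp_all add: degree_def doubleton_eq_iff)
  then have "{v \<in> verts G. degree G v = card (verts G) - 1} = {0, 1, 2}"
    by (auto simp: G_def)
  then show "card {v \<in> verts G. degree G v = card (verts G) - 1} = 3"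
    by simp
  show "card (edges G) mod 3 = 0"
    by (simp add: G_def doubleton_eq_iff)
  show "\<not> (\<exists>D. P4_decomposition G D)"
  proof
    assume "\<exists>D. P4_decomposition G D"
    then obtain D where D: "P4_decomposition G D" ..
    have "edges G \<noteq> {}"
      by (simp add: G_def)
    with D obtain H where H: "H \<in> D"
      unfolding P4_decomposition_def by fastforce
    with D have sub: "subgraph H G" and iso: "graph_iso H (path_graph 4)"
      by (auto simp: P4_decomposition_def)
    from iso have "card (verts H) = 4"
      by (auto simp: graph_iso_def path_graph_def dest: bij_betw_same_card)
    moreover from sub have "card (verts H) \<le> card (verts G)"
      by (intro card_mono) (auto simp: subgraph_def G_def)
    ultimately show False
      by (simp add: G_def)
  qed
qed

end

theory Submission
  imports Defs
begin

text \<open>Let \<open>x\<close> and \<open>y\<close> be two vertices of full degree, \<open>W\<close> the set of the other vertices and \<open>F\<close> the set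
  of edges inside \<open>W\<close>. Setting the edge \<open>xy\<close> aside, one removes edge-disjoint copies of \<open>P\<^sub>4\<close> until
  nothing, one edge \<open>xu\<close>, or two edges \<open>xu\<close>, \<open>yv\<close> with \<open>u \<noteq> v\<close> are left; in the last case \<open>u x y v\<close>
  is one more path. This is an induction: a path \<open>P\<^sub>4\<close> inside \<open>F\<close> is removed directly, and if there is
  none, then \<open>F\<close> is a disjoint union of stars and triangles. Then a triangle, two leaves of a star,
  an isolated edge or two isolated vertices can be removed together with their edges to \<open>x\<close> and \<open>y\<close>.
  A single remaining vertex \<open>w\<close> of \<open>W\<close> is excluded, since \<open>xw\<close>, \<open>yw\<close>, \<open>xy\<close> form a triangle, so the
  step that would leave one is treated by an explicit decomposition.\<close>

section \<open>Removing paths one at a time from an edge set\<close>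

definition path_edges :: "'a \<Rightarrow> 'a \<Rightarrow> 'a \<Rightarrow> 'a \<Rightarrow> 'a set set" where
  "path_edges a b c d = {{a, b}, {b, c}, {c, d}}"

text \<open>Only edge sets are tracked and one path is removed per step, so an explicit
  decomposition reduces to equalities of small edge sets. The subgraphs are rebuilt in
  \<open>leave_P4_decomposition_with_rest\<close>.\<close>

inductive leave :: "'a set set \<Rightarrow> 'a set set \<Rightarrow> bool" for E where
  refl: "leave E E"
| step: "leave E (path_edges a b c d \<union> R) \<Longrightarrow> distinct [a, b, c, d] \<Longrightarrow>
    path_edges a b c d \<inter> R = {} \<Longrightarrow> leave E R"

lemma leaveI:
  assumes "leave E S" "distinct [a, b, c, d]" "S = path_edges a b c d \<union> R"
    "path_edges a b c d \<inter> R = {}"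
  shows "leave E R"
  using assms leave.step by metis

lemma leave_subset: "leave E R \<Longrightarrow> R \<subseteq> E"
  by (induction rule: leave.induct) auto

text \<open>The removed paths lie inside \<open>E\<close>, so edges outside \<open>E\<close> survive
  the whole process. This replays a decomposition of a smaller graph inside a larger one.\<close>

lemma leave_Un:
  assumes "leave E R" "E \<inter> D = {}"
  shows "leave (E \<union> D) (R \<union> D)"
  using assms
proof (induction rule: leave.induct)
  case refl
  show ?case by (auto intro: leave.refl)
next
  case (step a b c d R)
  then have "leave (E \<union> D) (path_edges a b c d \<union> R \<union> D)" "path_edges a b c d \<union> R \<subseteq> E"
    by (auto dest: leave_subset)
  with step.hyps step.prems show ?case
    by (auto intro!: leaveI[of "E \<union> D" "path_edges a b c d \<union> R \<union> D" a b c d])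
qed

lemma leave_trans: "leave S T \<Longrightarrow> leave E S \<Longrightarrow> leave E T"
  by (induction rule: leave.induct) (auto intro: leave.step)

lemma card_path_edges: "distinct [a, b, c, d] \<Longrightarrow> card (path_edges a b c d) = 3"
  by (auto simp: path_edges_def doubleton_eq_iff)

text \<open>Each removal takes exactly three edges. Once at most two edges remain, this determines
  their number.\<close>

lemma card_leave:
  assumes "leave E R" "finite E"
  shows "card R mod 3 = card E mod 3"
  using assms
proof (induction rule: leave.induct)
  case (step a b c d R)
  then have "finite R"
    using leave_subset finite_subset by (metis Un_upper2 order_trans)
  with step show ?case
    by (simp add: card_Un_disjoint card_path_edges path_edges_def[of a b c d, THEN arg_cong[of _ _ finite]])
qed simp

section \<open>Joins with two vertices and the admissible remainders\<close>

text \<open>For edges \<open>F\<close> inside \<open>W\<close> and \<open>x\<close>,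
  \<open>y\<close> outside \<open>W\<close>, this is the join of the graph \<open>(W, F)\<close>
  with the edgeless graph on \<open>x\<close>, \<open>y\<close>. The same formula describes the
  portion removed with a vertex set \<open>S\<close>; the edges \<open>T\<close> may then have an
  end outside \<open>S\<close>.\<close>

definition cone2 :: "'a \<Rightarrow> 'a \<Rightarrow> 'a set \<Rightarrow> 'a set set \<Rightarrow> 'a set set" where
  "cone2 x y W F = (\<lambda>w. {x, w}) ` W \<union> (\<lambda>w. {y, w}) ` W \<union> F"

text \<open>The old edges avoid \<open>S\<close> while every new edge meets \<open>S\<close>, so the
  two sets are disjoint and \<open>leave_Un\<close> applies.\<close>

lemma leave_cone2_Un:
  assumes "leave (cone2 x y W F) R" "\<forall>e\<in>F. e \<subseteq> W" "\<forall>e\<in>T. e \<inter> S \<noteq> {}"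
    "S \<inter> insert x (insert y W) = {}"
  shows "leave (cone2 x y (W \<union> S) (F \<union> T)) (R \<union> cone2 x y S T)"
proof -
  have "e \<subseteq> insert x (insert y W)" if "e \<in> cone2 x y W F" for e
    using that assms(2) by (auto simp: cone2_def)
  moreover have "e \<inter> S \<noteq> {}" if "e \<in> cone2 x y S T" for e
    using that assms(3) by (auto simp: cone2_def)
  ultimately have "cone2 x y W F \<inter> cone2 x y S T = {}"
    using assms(4) by blast
  moreover have "cone2 x y (W \<union> S) (F \<union> T) = cone2 x y W F \<union> cone2 x y S T"
    by (auto simp: cone2_def)
  ultimately show ?thesis
    using leave_Un[OF assms(1)] by simp
qed

text \<open>One shape for each residue of the edge count modulo 3. Distinct ends \<open>u\<close>
  and \<open>v\<close> ensure that adding the edge \<open>xy\<close> completes a path.\<close>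

definition small_leave :: "'a \<Rightarrow> 'a \<Rightarrow> 'a set \<Rightarrow> 'a set set \<Rightarrow> bool" where
  "small_leave x y W R \<longleftrightarrow> R = {} \<or> (\<exists>u\<in>W. R = {{x, u}}) \<or>
     (\<exists>u\<in>W. \<exists>v\<in>W. u \<noteq> v \<and> R = {{x, u}, {y, v}})"

lemma small_leave_one: "u \<in> W \<Longrightarrow> small_leave x y W {{x, u}}"
  unfolding small_leave_def by blast

lemma small_leave_two:
  "u \<in> W \<Longrightarrow> v \<in> W \<Longrightarrow> u \<noteq> v \<Longrightarrow> small_leave x y W {{x, u}, {y, v}}"
  unfolding small_leave_def by blast

lemma small_leave_mono: "small_leave x y W R \<Longrightarrow> W \<subseteq> W' \<Longrightarrow> small_leave x y W' R"
  unfolding small_leave_def by blast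

section \<open>Removing vertices of \<open>W\<close> together with their edges\<close>

text \<open>The six edges at \<open>a\<close> and \<open>b\<close> form two paths by themselves, so
  \<open>R\<close> is untouched and may contain further edges at the centre
  \<open>c\<close>.\<close>

lemma leave_two_leaves:
  assumes "distinct [x, y, c, a, b]" "R \<inter> cone2 x y {a, b} {{c, a}, {c, b}} = {}"
  shows "leave (R \<union> cone2 x y {a, b} {{c, a}, {c, b}}) R"
proof -
  have "leave (R \<union> cone2 x y {a, b} {{c, a}, {c, b}}) (R \<union> path_edges x b c a)"
    using assms by (intro leaveI[OF leave.refl, of x a y b])
      (auto simp: cone2_def path_edges_def doubleton_eq_iff insert_commute)
  then show ?thesis
    using assms by (elim leaveI[of _ _ x b c a])
      (auto simp: cone2_def path_edges_def insert_commute)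
qed

text \<open>The nine edges split cyclically: each side of the triangle is the middle edge of a path
  from \<open>x\<close> to \<open>y\<close>.\<close>

lemma leave_triangle:
  assumes "distinct [x, y, a, b, c]" "R \<inter> cone2 x y {a, b, c} {{a, b}, {b, c}, {c, a}} = {}"
  shows "leave (R \<union> cone2 x y {a, b, c} {{a, b}, {b, c}, {c, a}}) R"
proof -
  have "leave (R \<union> cone2 x y {a, b, c} {{a, b}, {b, c}, {c, a}})
      (R \<union> path_edges x b c y \<union> path_edges x c a y)"
    using assms by (intro leaveI[OF leave.refl, of x a b y])
      (auto simp: cone2_def path_edges_def doubleton_eq_iff insert_commute)
  then have "leave (R \<union> cone2 x y {a, b, c} {{a, b}, {b, c}, {c, a}}) (R \<union> path_edges x c a y)"
    using assms by (elim leaveI[of _ _ x b c y])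
      (auto simp: cone2_def path_edges_def doubleton_eq_iff insert_commute)
  then show ?thesis
    using assms by (elim leaveI[of _ _ x c a y])
      (auto simp: cone2_def path_edges_def insert_commute)
qed

text \<open>Five new edges shift the size of the remainder by 2 modulo 3, so sizes 0, 1, 2 become 2,
  0, 1. Old edges are absorbed as first edges of new paths.\<close>

lemma leave_edge:
  assumes "small_leave x y W R" "distinct [x, y, a, b]" "{x, y, a, b} \<inter> W = {}"
  shows "\<exists>R'. small_leave x y (W \<union> {a, b}) R' \<and> leave (R \<union> cone2 x y {a, b} {{a, b}}) R'"
proof -
  let ?D = "cone2 x y {a, b} {{a, b}}"
  consider "R = {}" | u where "u \<in> W" "R = {{x, u}}"
    | u v where "u \<in> W" "v \<in> W" "u \<noteq> v" "R = {{x, u}, {y, v}}"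
    using assms(1) unfolding small_leave_def by blast
  then show ?thesis
  proof cases
    case 1
    have "leave (R \<union> ?D) {{x, b}, {y, a}}"
      using assms(2) 1 by (intro leaveI[OF leave.refl, of x a b y])
        (auto simp: cone2_def path_edges_def doubleton_eq_iff insert_commute)
    moreover have "small_leave x y (W \<union> {a, b}) {{x, b}, {y, a}}"
      using assms(2) by (intro small_leave_two) auto
    ultimately show ?thesis by blast
  next
    case 2
    then have ne: "u \<notin> {x, y, a, b}" using assms(3) by auto
    have "leave (R \<union> ?D) (path_edges x b y a)"
      using assms(2) 2 ne by (intro leaveI[OF leave.refl, of u x a b])
        (auto simp: cone2_def path_edges_def doubleton_eq_iff insert_commute)
    then have "leave (R \<union> ?D) {}"
      using assms(2) by (elim leaveI[of _ _ x b y a]) auto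
    then show ?thesis unfolding small_leave_def by blast
  next
    case 3
    then have ne: "u \<notin> {x, y, a, b}" "v \<notin> {x, y, a, b}" using assms(3) by auto
    have "leave (R \<union> ?D) (insert {x, a} (path_edges u x b y))"
      using assms(2) 3 ne by (intro leaveI[OF leave.refl, of v y a b])
        (auto simp: cone2_def path_edges_def doubleton_eq_iff insert_commute)
    then have "leave (R \<union> ?D) {{x, a}}"
      using assms(2) 3 ne by (elim leaveI[of _ _ u x b y])
        (auto simp: path_edges_def doubleton_eq_iff)
    moreover have "small_leave x y (W \<union> {a, b}) {{x, a}}"
      by (intro small_leave_one) simp
    ultimately show ?thesis by blast
  qed
qed

text \<open>Four new edges shift the size of the remainder by 1 modulo 3, so sizes 0, 1, 2 become 1,
  2, 0.\<close>

lemma leave_two_isolated: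
  assumes "small_leave x y W R" "distinct [x, y, a, b]" "{x, y, a, b} \<inter> W = {}"
  shows "\<exists>R'. small_leave x y (W \<union> {a, b}) R' \<and> leave (R \<union> cone2 x y {a, b} {}) R'"
proof -
  let ?D = "cone2 x y {a, b} {}"
  consider "R = {}" | u where "u \<in> W" "R = {{x, u}}"
    | u v where "u \<in> W" "v \<in> W" "u \<noteq> v" "R = {{x, u}, {y, v}}"
    using assms(1) unfolding small_leave_def by blast
  then show ?thesis
  proof cases
    case 1
    have "leave (R \<union> ?D) {{x, b}}"
      using assms(2) 1 by (intro leaveI[OF leave.refl, of x a y b])
        (auto simp: cone2_def path_edges_def doubleton_eq_iff insert_commute)
    moreover have "small_leave x y (W \<union> {a, b}) {{x, b}}"
      by (intro small_leave_one) simp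
    ultimately show ?thesis by blast
  next
    case 2
    then have ne: "u \<notin> {x, y, a, b}" using assms(3) by auto
    \<comment> \<open>The old edge \<open>xu\<close> is kept: with the new edge \<open>ya\<close> it
      has the two-edge shape, since \<open>u\<close> and \<open>a\<close> differ.\<close>
    have "leave (R \<union> ?D) {{x, u}, {y, a}}"
      using assms(2) 2 ne by (intro leaveI[OF leave.refl, of a x b y])
        (auto simp: cone2_def path_edges_def doubleton_eq_iff insert_commute)
    moreover have "small_leave x y (W \<union> {a, b}) {{x, u}, {y, a}}"
      using 2 ne by (intro small_leave_two) auto
    ultimately show ?thesis by blast
  next
    case 3
    then have ne: "u \<notin> {x, y, a, b}" "v \<notin> {x, y, a, b}" using assms(3) by auto
    have "leave (R \<union> ?D) (path_edges v y b x)"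
      using assms(2) 3 ne by (intro leaveI[OF leave.refl, of u x a y])
        (auto simp: cone2_def path_edges_def doubleton_eq_iff insert_commute)
    then have "leave (R \<union> ?D) {}"
      using assms(2) ne by (elim leaveI[of _ _ v y b x]) auto
    then show ?thesis unfolding small_leave_def by blast
  qed
qed

section \<open>Explicit decompositions for the cases where a reduction would strand one
  vertex\<close>

lemma three_isolated:
  assumes "distinct [x, y, a, b, c]"
  shows "leave (cone2 x y {a, b, c} {}) {}"
proof -
  have "leave (cone2 x y {a, b, c} {}) (path_edges b x c y)"
    using assms by (intro leaveI[OF leave.refl, of x a y b])
      (auto simp: cone2_def path_edges_def doubleton_eq_iff insert_commute)
  then show ?thesis
    using assms by (elim leaveI[of _ _ b x c y]) auto
qed

lemma isolated_edge:
  assumes "distinct [x, y, a, b, w]"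
  shows "leave (cone2 x y {a, b, w} {{a, b}}) {{x, a}}"
proof -
  have "leave (cone2 x y {a, b, w} {{a, b}}) (insert {x, a} (path_edges b y w x))"
    using assms by (intro leaveI[OF leave.refl, of y a b x])
      (auto simp: cone2_def path_edges_def doubleton_eq_iff insert_commute)
  then show ?thesis
    using assms by (elim leaveI[of _ _ b y w x])
      (auto simp: path_edges_def doubleton_eq_iff)
qed

lemma isolated_triangle:
  assumes "distinct [x, y, a, b, c, w]"
  shows "leave (cone2 x y {a, b, c, w} {{a, b}, {b, c}, {c, a}}) {{x, a}, {y, b}}"
proof -
  let ?E = "cone2 x y {a, b, c, w} {{a, b}, {b, c}, {c, a}}"
  have "leave ?E ({{x, a}, {y, b}} \<union> path_edges y a c b \<union> path_edges c x b a)"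
    using assms by (intro leaveI[OF leave.refl, of x w y c])
      (auto simp: cone2_def path_edges_def doubleton_eq_iff insert_commute)
  then have "leave ?E ({{x, a}, {y, b}} \<union> path_edges c x b a)"
    using assms by (elim leaveI[of _ _ y a c b])
      (auto simp: path_edges_def doubleton_eq_iff)
  then show ?thesis
    using assms by (elim leaveI[of _ _ c x b a])
      (auto simp: path_edges_def doubleton_eq_iff)
qed

text \<open>Here the stranded vertex would be the centre \<open>c\<close> itself.\<close>

lemma two_leaves:
  assumes "distinct [x, y, a, b, c]"
  shows "leave (cone2 x y {a, b, c} {{c, a}, {c, b}}) {{x, a}, {y, b}}"
proof -
  have "leave (cone2 x y {a, b, c} {{c, a}, {c, b}}) ({{x, a}, {y, b}} \<union> path_edges y a c x)"
    using assms by (intro leaveI[OF leave.refl, of x b c y])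
      (auto simp: cone2_def path_edges_def doubleton_eq_iff insert_commute)
  then show ?thesis
    using assms by (elim leaveI[of _ _ y a c x])
      (auto simp: path_edges_def doubleton_eq_iff)
qed

section \<open>The induction on the join\<close>

lemma two_elements: "2 \<le> card A \<Longrightarrow> \<exists>a\<in>A. \<exists>b\<in>A. a \<noteq> b"
  by (erule obtain_subset_with_card_n) (auto simp: card_2_iff)

text \<open>For \<open>card W = 1\<close> the conclusion fails: the only edges \<open>xw\<close> and
  \<open>yw\<close> share the end \<open>w\<close>, so they are no admissible remainder, and they
  contain no path to remove.\<close>

lemma cone2_small_leave:
  assumes "finite W" "x \<notin> W" "y \<notin> W" "x \<noteq> y" "\<forall>e\<in>F. e \<subseteq> W \<and> card e = 2" "card W \<noteq> 1"
  shows "\<exists>R. small_leave x y W R \<and> leave (cone2 x y W F) R"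
  using assms
\<comment> \<open>The measure includes \<open>card F\<close> because removing a path inside
  \<open>F\<close> keeps \<open>W\<close>; every other reduction removes vertices.\<close>
proof (induction "card W + card F" arbitrary: W F rule: less_induct)
  case less
  note W = less.prems(1-3) and F = less.prems(5) and xy = \<open>x \<noteq> y\<close>
  have "F \<subseteq> Pow W" using F by auto
  then have finF: "finite F" using W(1) finite_subset by blast
  have edge: "u \<noteq> v \<and> u \<in> W \<and> v \<in> W" if "{u, v} \<in> F" for u v
    using F that by (cases "u = v") auto
  have edgeE: "\<exists>u v. e = {u, v} \<and> u \<noteq> v" if "e \<in> F" for e
    using F that card_2_iff by metis
  \<comment> \<open>\<open>T\<close> consists of exactly the edges of \<open>F\<close> that meet
    \<open>S\<close>, so \<open>F - T\<close> lies inside \<open>W - S\<close> and the induction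
    hypothesis applies there. The edges brought by \<open>S\<close> are then handled by the removal
    lemmas.\<close>
  have reduce: "\<exists>R. small_leave x y (W - S) R \<and> leave (cone2 x y W F) (R \<union> cone2 x y S T) \<and>
      R \<inter> cone2 x y S T = {}"
    if S: "S \<subseteq> W" "S \<noteq> {}" and T: "T \<subseteq> F" "\<forall>e\<in>T. e \<inter> S \<noteq> {}" "\<forall>e\<in>F - T. e \<inter> S = {}"
      and one: "card (W - S) \<noteq> 1" for S T
  proof -
    have "card (W - S) < card W"
      using S W(1) by (intro psubset_card_mono) auto
    moreover have "card (F - T) \<le> card F"
      using finF by (simp add: card_mono)
    ultimately have "card (W - S) + card (F - T) < card W + card F" by simp
    moreover have "\<forall>e\<in>F - T. e \<subseteq> W - S \<and> card e = 2" using F T by blast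
    ultimately have "\<exists>R. small_leave x y (W - S) R \<and> leave (cone2 x y (W - S) (F - T)) R"
      using W xy one by (intro less.hyps) simp_all
    then obtain R where R: "small_leave x y (W - S) R" "leave (cone2 x y (W - S) (F - T)) R"
      by blast
    have sub: "\<forall>e\<in>F - T. e \<subseteq> W - S" using F T by blast
    have "S \<inter> insert x (insert y (W - S)) = {}" using S W by auto
    from leave_cone2_Un[OF R(2) sub T(2) this]
    have "leave (cone2 x y W F) (R \<union> cone2 x y S T)"
      using S T by (simp add: Un_absorb2)
    moreover have "\<forall>e\<in>R. e \<inter> S = {}"
      using R(1) S W unfolding small_leave_def by auto
    moreover have "\<forall>e\<in>cone2 x y S T. e \<inter> S \<noteq> {}"
      using T(2) by (auto simp: cone2_def)
    ultimately show ?thesis using R(1) by (meson disjoint_iff)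
  qed
  \<comment> \<open>An edge of \<open>F - T\<close> would need two vertices in a one-element set.
    Hence \<open>F\<close> is completely known in the exceptional cases.\<close>
  have no_rest: "F = T" if "card (W - S) = 1" "T \<subseteq> F" "\<forall>e\<in>F - T. e \<inter> S = {}" for S T
  proof -
    have False if "e \<in> F - T" for e
    proof -
      have "e \<subseteq> W - S" "card e = 2" using F that \<open>\<forall>e\<in>F - T. e \<inter> S = {}\<close> by auto
      then show False
        using card_mono[of "W - S" e] W(1) \<open>card (W - S) = 1\<close> by simp
    qed
    with \<open>T \<subseteq> F\<close> show ?thesis by blast
  qed
  show ?case
  proof (cases "\<exists>a b c d. distinct [a, b, c, d] \<and> path_edges a b c d \<subseteq> F")
    case True
    then obtain a b c d where d: "distinct [a, b, c, d]" and P: "path_edges a b c d \<subseteq> F" by blast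
    let ?P = "path_edges a b c d"
    have "card (F - ?P) < card F"
      using P finF by (intro psubset_card_mono) (auto simp: path_edges_def)
    then obtain R where R: "small_leave x y W R" "leave (cone2 x y W (F - ?P)) R"
      using less.hyps[of W "F - ?P"] less.prems by auto
    have disj: "cone2 x y W (F - ?P) \<inter> ?P = {}"
    proof -
      have "\<forall>e\<in>?P. e \<subseteq> W" using P F by blast
      with W(2,3) show ?thesis by (auto simp: cone2_def)
    qed
    moreover have "cone2 x y W (F - ?P) \<union> ?P = cone2 x y W F"
      using P by (auto simp: cone2_def)
    ultimately have "leave (cone2 x y W F) (R \<union> ?P)"
      using leave_Un[OF R(2)] by metis
    moreover have "?P \<inter> R = {}"
      using disj leave_subset[OF R(2)] by blast
    ultimately have "leave (cone2 x y W F) R"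
      using d by (auto intro: leaveI)
    with R(1) show ?thesis by blast
  next
    case False
    \<comment> \<open>A walk of three edges without backtracking (\<open>a \<noteq> c\<close>,
      \<open>d \<noteq> b\<close>) must close up to a triangle, as otherwise it is a path inside
      \<open>F\<close>.\<close>
    have noP: "d = a" if "{a, b} \<in> F" "{b, c} \<in> F" "{c, d} \<in> F" "a \<noteq> c" "d \<noteq> b" for a b c d
    proof (rule ccontr)
      assume "d \<noteq> a"
      with that edge[of a b] edge[of b c] edge[of c d]
      have "distinct [a, b, c, d]" "path_edges a b c d \<subseteq> F" by (auto simp: path_edges_def)
      with False show False by blast
    qed
    have inc: "\<exists>d. e = {u, d} \<and> {u, d} \<in> F" if "e \<in> F" "u \<in> e" for e u
      using edgeE[OF that(1)] that by (metis insertE insert_commute singletonD)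
    show ?thesis
    proof (cases "\<exists>a b c. {c, a} \<in> F \<and> {c, b} \<in> F \<and> a \<noteq> b")
      case True
      then obtain a b c where abc: "{c, a} \<in> F" "{c, b} \<in> F" "a \<noteq> b" by blast
      then have abc': "{a, c} \<in> F" "{b, c} \<in> F" by (simp_all add: insert_commute)
      have dist: "distinct [x, y, a, b, c]" and inW: "{a, b, c} \<subseteq> W"
        using edge[OF abc(1)] edge[OF abc(2)] abc(3) W xy by auto
      \<comment> \<open>Any further neighbour \<open>d\<close> of \<open>a\<close> would give the
        path \<open>b c a d\<close>.\<close>
      have na: "d = c \<or> d = b" if "{a, d} \<in> F" for d
        using noP[of b c a d] that abc abc' by auto
      have nb: "d = c \<or> d = a" if "{b, d} \<in> F" for d
        using noP[of a c b d] that abc abc' by auto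
      show ?thesis
      proof (cases "{a, b} \<in> F")
        case True
        \<comment> \<open>With \<open>ab\<close> present, \<open>c\<close> has no further neighbour
          either, so the triangle is a component of \<open>F\<close>.\<close>
        have nc: "d = a \<or> d = b" if "{c, d} \<in> F" for d
          using noP[of b a c d] that abc abc' True dist by (auto simp: insert_commute)
        let ?S = "{a, b, c}" and ?T = "{{a, b}, {b, c}, {c, a}}"
        have T: "?T \<subseteq> F" using True abc abc' by auto
        have cl: "\<forall>e\<in>F - ?T. e \<inter> ?S = {}"
        proof (rule ccontr)
          assume "\<not> ?thesis"
          then obtain e u where e: "e \<in> F" "e \<notin> ?T" "u \<in> e" "u \<in> {a, b, c}" by blast
          with inc[of e u] obtain d where "e = {u, d}" "{u, d} \<in> F" by blast
          with e na nb nc show False by (auto simp: insert_commute)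
        qed
        show ?thesis
        proof (cases "card (W - ?S) = 1")
          case True
          then obtain w where w: "W - ?S = {w}" by (auto simp: card_1_singleton_iff)
          then have "W = {a, b, c, w}" "w \<notin> {a, b, c}" using inW by auto
          moreover have "F = ?T" using no_rest[OF True T cl] .
          moreover have "small_leave x y W {{x, a}, {y, b}}"
            using inW dist by (intro small_leave_two) auto
          moreover have "w \<noteq> x" "w \<noteq> y" using w W by auto
          ultimately show ?thesis
            using isolated_triangle[of x y a b c w] dist by auto
        next
          case False
          from reduce[OF inW _ T _ cl this] obtain R where R: "small_leave x y (W - ?S) R"
            "leave (cone2 x y W F) (R \<union> cone2 x y ?S ?T)" "R \<inter> cone2 x y ?S ?T = {}" by auto
          then have "leave (cone2 x y W F) R"
            using leave_triangle[OF dist R(3)] leave_trans by blast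
          with R(1) show ?thesis using small_leave_mono[of x y _ R W] by blast
        qed
      next
        case False
        \<comment> \<open>Without \<open>ab\<close>, both \<open>a\<close> and \<open>b\<close> have
          \<open>c\<close> as their only neighbour in \<open>F\<close>. The centre \<open>c\<close>
          stays in \<open>W\<close>, as it may have more leaves.\<close>
        let ?S = "{a, b}" and ?T = "{{c, a}, {c, b}}"
        have T: "?T \<subseteq> F" using abc by auto
        have S: "?S \<subseteq> W" using inW by auto
        have cl: "\<forall>e\<in>F - ?T. e \<inter> ?S = {}"
        proof (rule ccontr)
          assume "\<not> ?thesis"
          then obtain e u where e: "e \<in> F" "e \<notin> ?T" "u \<in> e" "u \<in> {a, b}" by blast
          with inc[of e u] obtain d where "e = {u, d}" "{u, d} \<in> F" by blast
          moreover have "{b, a} \<notin> F" using False by (simp add: insert_commute)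
          ultimately show False using e na nb False by (auto simp: doubleton_eq_iff)
        qed
        show ?thesis
        proof (cases "card (W - ?S) = 1")
          case True
          then obtain w where w: "W - ?S = {w}" by (auto simp: card_1_singleton_iff)
          moreover have "c \<in> W - ?S" using inW dist by auto
          ultimately have "W = {a, b, c}" using inW by auto
          moreover have "F = ?T" using no_rest[OF True T cl] .
          moreover have "small_leave x y W {{x, a}, {y, b}}"
            using inW dist by (intro small_leave_two) auto
          ultimately show ?thesis
            using two_leaves[OF dist] by auto
        next
          case False
          from reduce[OF S _ T _ cl this] obtain R where R: "small_leave x y (W - ?S) R"
            "leave (cone2 x y W F) (R \<union> cone2 x y ?S ?T)" "R \<inter> cone2 x y ?S ?T = {}" by auto
          have "distinct [x, y, c, a, b]" using dist by auto
          then have "leave (cone2 x y W F) R"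
            using leave_two_leaves[OF _ R(3)] leave_trans R(2) by blast
          with R(1) show ?thesis using small_leave_mono[of x y _ R W] by blast
        qed
      qed
    next
      case False
      \<comment> \<open>No two edges of \<open>F\<close> share a vertex now, so \<open>F\<close> is
        a matching.\<close>
      show ?thesis
      proof (cases "F = {}")
        case True
        show ?thesis
        proof (cases "W = {}")
          case True
          with \<open>F = {}\<close> show ?thesis
            using leave.refl[of "{}"] by (auto simp: cone2_def small_leave_def)
        next
          case False
          then have "card W \<ge> 2" using W(1) less.prems(6) by (cases "card W") auto
          then obtain a b where ab: "a \<in> W" "b \<in> W" "a \<noteq> b"
            using two_elements by blast
          let ?S = "{a, b}"
          have S: "?S \<subseteq> W" using ab by auto
          show ?thesis
          proof (cases "card (W - ?S) = 1")
            case True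
            then obtain w where w: "W - ?S = {w}" by (auto simp: card_1_singleton_iff)
            then have "W = {a, b, w}" "w \<notin> {a, b}" using S by auto
            moreover have "w \<noteq> x" "w \<noteq> y" using w W by auto
            moreover have "small_leave x y W {}" by (simp add: small_leave_def)
            ultimately show ?thesis
              using three_isolated[of x y a b w] ab W xy \<open>F = {}\<close> by auto
          next
            case False
            from reduce[of ?S "{}", OF S _ _ _ _ this] \<open>F = {}\<close>
            obtain R where R: "small_leave x y (W - ?S) R"
              "leave (cone2 x y W F) (R \<union> cone2 x y ?S {})" by auto
            have "distinct [x, y, a, b]" "{x, y, a, b} \<inter> (W - ?S) = {}" using ab W xy by auto
            then obtain R' where "small_leave x y (W - ?S \<union> ?S) R'" "leave (R \<union> cone2 x y ?S {}) R'"
              using leave_two_isolated[OF R(1)] by blast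
            moreover have "W - ?S \<union> ?S = W" using S by auto
            ultimately show ?thesis
              using leave_trans[OF _ R(2)] by auto
          qed
        qed
      next
        case ne: False
        then obtain a b where ab: "{a, b} \<in> F" using edgeE by blast
        let ?S = "{a, b}" and ?T = "{{a, b}}"
        have abW: "a \<noteq> b" "a \<in> W" "b \<in> W" using edge[OF ab] by auto
        have S: "?S \<subseteq> W" and T: "?T \<subseteq> F" using abW ab by auto
        have cl: "\<forall>e\<in>F - ?T. e \<inter> ?S = {}"
        proof (rule ccontr)
          assume "\<not> ?thesis"
          then obtain e u where e: "e \<in> F" "e \<notin> ?T" "u \<in> e" "u \<in> {a, b}" by blast
          with inc[of e u] obtain d where "e = {u, d}" "{u, d} \<in> F" by blast
          with e False ab show False by (metis insertE insert_commute singletonD singletonI)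
        qed
        show ?thesis
        proof (cases "card (W - ?S) = 1")
          case True
          then obtain w where w: "W - ?S = {w}" by (auto simp: card_1_singleton_iff)
          then have "W = {a, b, w}" "w \<notin> {a, b}" using S by auto
          moreover have "w \<noteq> x" "w \<noteq> y" using w W by auto
          moreover have "small_leave x y W {{x, a}}" using abW by (intro small_leave_one)
          moreover have "F = ?T" using no_rest[OF True T cl] .
          ultimately show ?thesis
            using isolated_edge[of x y a b w] abW W xy by auto
        next
          case False
          from reduce[OF S _ T _ cl this]
          obtain R where R: "small_leave x y (W - ?S) R"
            "leave (cone2 x y W F) (R \<union> cone2 x y ?S ?T)" by auto
          have "distinct [x, y, a, b]" "{x, y, a, b} \<inter> (W - ?S) = {}" using abW W xy by auto
          then obtain R' where "small_leave x y (W - ?S \<union> ?S) R'" "leave (R \<union> cone2 x y ?S ?T) R'"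
            using leave_edge[OF R(1)] by blast
          moreover have "W - ?S \<union> ?S = W" using S by auto
          ultimately show ?thesis
            using leave_trans[OF _ R(2)] by auto
        qed
      qed
    qed
  qed
qed

section \<open>The graph \<open>P4\<close> and the edge count of a decomposition\<close>

lemma edges_path_graph_4: "edges (path_graph 4) = {{0, 1}, {1, 2}, {2, 3}}"
proof -
  have "edges (path_graph 4) = (\<lambda>i. {i, Suc i}) ` {i. Suc i < 4}"
    by (auto simp: path_graph_def)
  also have "{i. Suc i < 4} = {0, 1, 2}" by auto
  finally show ?thesis by (simp add: numeral_2_eq_2 numeral_3_eq_3)
qed

lemma verts_path_graph_4: "verts (path_graph 4) = {0, 1, 2, 3}"
  by (auto simp: path_graph_def)

lemma graph_iso_path_edges:
  assumes "distinct [a, b, c, d]"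
  shows "graph_iso ({a, b, c, d}, path_edges a b c d) (path_graph 4)"
proof -
  define f where "f v = (if v = a then 0 else if v = b then 1 else if v = c then 2 else 3 :: nat)" for v
  have f: "f a = 0" "f b = 1" "f c = 2" "f d = 3"
    using assms by (auto simp: f_def)
  have "bij_betw f {a, b, c, d} {0, 1, 2, 3}"
    using f by (auto simp: bij_betw_def inj_on_def)
  then show ?thesis
    unfolding graph_iso_def verts_path_graph_4 edges_path_graph_4 using f assms
    by (intro exI[of _ f]) (auto simp: path_edges_def doubleton_eq_iff)
qed

text \<open>An isomorphism \<open>f\<close> acts on edges by taking images. This action is injective
  on subsets of \<open>verts H\<close>, and it maps \<open>edges H\<close> onto the edges of the
  path because every edge is a pair of vertices.\<close>

lemma card_edges_path_4:
  assumes "simple_graph H" "graph_iso H (path_graph 4)"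
  shows "card (edges H) = 3"
proof -
  obtain f where f: "bij_betw f (verts H) (verts (path_graph 4))"
    and adj: "\<And>u v. u \<in> verts H \<Longrightarrow> v \<in> verts H \<Longrightarrow>
      {u, v} \<in> edges H \<longleftrightarrow> {f u, f v} \<in> edges (path_graph 4)"
    using assms(2) unfolding graph_iso_def by blast
  have eH: "\<exists>u v. e = {u, v} \<and> u \<in> verts H \<and> v \<in> verts H" if "e \<in> edges H" for e
    using assms(1) that unfolding simple_graph_def card_2_iff by (metis insert_subset)
  have eP: "\<exists>u v. e = {f u, f v} \<and> u \<in> verts H \<and> v \<in> verts H" if "e \<in> edges (path_graph 4)" for e
  proof -
    have "\<exists>i j. e = {i, j} \<and> i \<in> f ` verts H \<and> j \<in> f ` verts H"
      using that f unfolding bij_betw_def verts_path_graph_4 edges_path_graph_4 by auto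
    then show ?thesis by blast
  qed
  have "inj_on ((`) f) (edges H)"
    using f assms(1) unfolding simple_graph_def bij_betw_def
    by (meson inj_on_image_Pow inj_on_subset PowI subsetI)
  moreover have "(`) f ` edges H = edges (path_graph 4)"
  proof
    show "(`) f ` edges H \<subseteq> edges (path_graph 4)"
      using eH adj by fastforce
    show "edges (path_graph 4) \<subseteq> (`) f ` edges H"
    proof
      fix e assume e: "e \<in> edges (path_graph 4)"
      with eP obtain u v where "e = {f u, f v}" "u \<in> verts H" "v \<in> verts H" by blast
      with e adj have "{u, v} \<in> edges H" "e = f ` {u, v}" by auto
      then show "e \<in> (`) f ` edges H" by blast
    qed
  qed
  ultimately have "card (edges H) = card (edges (path_graph 4))"
    using card_image by metis
  also have "\<dots> = 3"
    unfolding edges_path_graph_4 by (simp add: doubleton_eq_iff)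
  finally show ?thesis .
qed

lemma finite_edges: "simple_graph G \<Longrightarrow> finite (edges G)"
  unfolding simple_graph_def by (meson PowI finite_Pow_iff finite_subset subsetI)

lemma P4_decomposition_card:
  assumes "simple_graph G" "P4_decomposition G D"
  shows "card (edges G) = 3 * card D"
proof -
  have D: "subgraph H G" "graph_iso H (path_graph 4)" if "H \<in> D" for H
    using assms(2) that unfolding P4_decomposition_def by auto
  \<comment> \<open>Finiteness of \<open>D\<close> has to be derived, since \<open>card\<close> and
    sums default to 0 on infinite sets.\<close>
  have "D \<subseteq> Pow (verts G) \<times> Pow (edges G)"
    using D(1) by (force simp: subgraph_def)
  moreover have "finite (verts G)" "finite (edges G)"
    using assms(1) finite_edges[OF assms(1)] by (auto simp: simple_graph_def)
  ultimately have "finite D"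
    by (meson finite_Pow_iff finite_SigmaI finite_subset)
  have finH: "\<forall>H\<in>D. finite (edges H)"
    using D(1) by (simp add: subgraph_def finite_edges)
  have "card (edges G) = card (\<Union>H\<in>D. edges H)"
    using assms(2) by (simp add: P4_decomposition_def)
  also have "\<dots> = (\<Sum>H\<in>D. card (edges H))"
    using assms(2) \<open>finite D\<close> finH
    by (intro card_UN_disjoint) (simp_all add: P4_decomposition_def disjoint_family_on_def)
  also have "\<dots> = (\<Sum>H\<in>D. 3)"
    using D by (intro sum.cong) (simp_all add: subgraph_def card_edges_path_4)
  finally show ?thesis by simp
qed

section \<open>From removed edge sets back to subgraphs\<close>

text \<open>Each removed path, equipped with its four vertices, becomes a member of
  \<open>D\<close>. It is disjoint from the earlier members because they avoid the whole rest from
  which it is taken.\<close>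

lemma leave_P4_decomposition_with_rest:
  assumes "leave (edges G) R" "simple_graph G"
  shows "\<exists>D. P4_decomposition_with_rest G D R"
  using assms
proof (induction rule: leave.induct)
  case refl
  show ?case
    by (rule exI[of _ "{}"]) (simp add: P4_decomposition_with_rest_def disjoint_family_on_def)
next
  case (step a b c d R)
  let ?P = "path_edges a b c d"
  let ?H = "({a, b, c, d}, ?P)"
  obtain D where D: "P4_decomposition_with_rest G D (?P \<union> R)"
    using step by blast
  then have "?P \<subseteq> edges G"
    unfolding P4_decomposition_with_rest_def by blast
  moreover from this have "{a, b, c, d} \<subseteq> verts G"
    using step.prems unfolding simple_graph_def by (auto simp: path_edges_def)
  ultimately have "subgraph ?H G"
    using step.hyps(2) by (auto simp: subgraph_def simple_graph_def path_edges_def)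
  moreover have "edges K \<inter> ?P = {}" if "K \<in> D" for K
    using D that unfolding P4_decomposition_with_rest_def by blast
  then have "disjoint_family_on edges (insert ?H D)"
    using D unfolding P4_decomposition_with_rest_def disjoint_family_on_def by auto
  ultimately have "P4_decomposition_with_rest G (insert ?H D) R"
    using D step.hyps(3) graph_iso_path_edges[OF step.hyps(2)]
    unfolding P4_decomposition_with_rest_def by (simp add: Int_Un_distrib Un_ac)
  then show ?case ..
qed

section \<open>Vertices of full degree and the theorem\<close>

text \<open>The edges at \<open>v\<close> are among the pairs formed by \<open>v\<close> and another
  vertex. There are \<open>card (verts G) - 1\<close> such pairs, which is the degree of
  \<open>v\<close>, so every pair is an edge.\<close>

lemma full_degree_adjacent:
  assumes "simple_graph G" "degree G v = card (verts G) - 1" "v \<in> verts G" "u \<in> verts G" "u \<noteq> v"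
  shows "{v, u} \<in> edges G"
proof -
  let ?A = "{e \<in> edges G. v \<in> e}" and ?B = "(\<lambda>u. {v, u}) ` (verts G - {v})"
  have fin: "finite (verts G)" using assms(1) by (simp add: simple_graph_def)
  have "?A \<subseteq> ?B"
  proof
    fix e assume e: "e \<in> ?A"
    then have "e \<subseteq> verts G" "card e = 2" "v \<in> e" using assms(1) by (auto simp: simple_graph_def)
    then obtain w where "e = {v, w}" "v \<noteq> w" by (auto simp: card_2_iff)
    with \<open>e \<subseteq> verts G\<close> show "e \<in> ?B" by auto
  qed
  moreover have "card ?B = card ?A"
    using assms fin by (subst card_image) (auto simp: inj_on_def doubleton_eq_iff degree_def)
  ultimately have "?A = ?B" using fin by (intro card_subset_eq) auto
  with assms(4,5) show ?thesis by blast
qed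

theorem theorem2p2:
  fixes G :: "'a sgraph"
  assumes "simple_graph G"
    and "card {v \<in> verts G. degree G v = card (verts G) - 1} \<ge> 2"
    and "card (verts G) \<noteq> 3"
  shows "((\<exists>D. P4_decomposition G D) \<longleftrightarrow> card (edges G) mod 3 = 0) \<and>
    (card (edges G) mod 3 = 1 \<longrightarrow> (\<exists>D R. P4_decomposition_with_rest G D R \<and> card R = 1)) \<and>
    (card (edges G) mod 3 = 2 \<longrightarrow> (\<exists>D R. P4_decomposition_with_rest G D R \<and> card R = 2))"
proof -
  obtain x y where xy: "x \<in> verts G" "y \<in> verts G" "x \<noteq> y"
    and deg: "degree G x = card (verts G) - 1" "degree G y = card (verts G) - 1"
    using two_elements[OF assms(2)] by blast
  define W where "W = verts G - {x, y}"
  define F where "F = {e \<in> edges G. e \<subseteq> W}"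
  have fin: "finite (verts G)" using assms(1) by (simp add: simple_graph_def)
  have W: "finite W" "x \<notin> W" "y \<notin> W" using fin by (auto simp: W_def)
  have F: "\<forall>e\<in>F. e \<subseteq> W \<and> card e = 2"
    using assms(1) by (auto simp: F_def simple_graph_def)
  have "card W = card (verts G) - 2"
    using xy fin by (simp add: W_def card_Diff_subset)
  \<comment> \<open>The excluded order 3 is exactly the excluded case of the induction.\<close>
  then have "card W \<noteq> 1" using assms(3) by linarith
  from cone2_small_leave[OF W xy(3) F this]
  obtain R where R: "small_leave x y W R" "leave (cone2 x y W F) R" by blast
  have edges: "edges G = cone2 x y W F \<union> {{x, y}}"
  proof
    show "cone2 x y W F \<union> {{x, y}} \<subseteq> edges G"
      using full_degree_adjacent[OF assms(1) deg(1) xy(1)] full_degree_adjacent[OF assms(1) deg(2) xy(2)] xy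
      by (auto simp: cone2_def F_def W_def)
    show "edges G \<subseteq> cone2 x y W F \<union> {{x, y}}"
    proof
      fix e assume e: "e \<in> edges G"
      then have "e \<subseteq> verts G" "card e = 2" using assms(1) by (auto simp: simple_graph_def)
      then obtain u v where "e = {u, v}" "u \<noteq> v" "u \<in> verts G" "v \<in> verts G"
        by (auto simp: card_2_iff)
      with e show "e \<in> cone2 x y W F \<union> {{x, y}}"
        by (cases "u \<in> W"; cases "v \<in> W") (auto simp: cone2_def F_def W_def insert_commute)
    qed
  qed
  have "cone2 x y W F \<inter> {{x, y}} = {}"
    using W xy F by (auto simp: cone2_def doubleton_eq_iff)
  then have leave: "leave (edges G) (R \<union> {{x, y}})"
    using leave_Un[OF R(2)] edges by metis
  \<comment> \<open>Two remaining edges combine with \<open>xy\<close> into the path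
    \<open>u x y v\<close>; otherwise \<open>xy\<close> joins a remainder of at most one
    edge.\<close>
  have "\<exists>R'. leave (edges G) R' \<and> card R' \<le> 2"
  proof (cases "\<exists>u\<in>W. \<exists>v\<in>W. u \<noteq> v \<and> R = {{x, u}, {y, v}}")
    case True
    then obtain u v where uv: "u \<in> W" "v \<in> W" "u \<noteq> v" "R = {{x, u}, {y, v}}" by blast
    then have "leave (edges G) {}"
      using leave xy(3) W by (elim leaveI[of _ _ u x y v]) (auto simp: path_edges_def insert_commute)
    then show ?thesis by force
  next
    case False
    then have "R = {} \<or> (\<exists>u\<in>W. R = {{x, u}})"
      using R(1) unfolding small_leave_def by blast
    then have "card (R \<union> {{x, y}}) \<le> 2"
      by (auto simp: card_insert_if)
    with leave show ?thesis by blast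
  qed
  then obtain R' where R': "leave (edges G) R'" "card R' \<le> 2" by blast
  \<comment> \<open>A number at most 2 is its own residue modulo 3, so the size of the rest is exact
    and all three cases follow together.\<close>
  have "card R' = card (edges G) mod 3"
    using card_leave[OF R'(1) finite_edges[OF assms(1)]] R'(2) by simp
  moreover obtain D where D: "P4_decomposition_with_rest G D R'"
    using leave_P4_decomposition_with_rest[OF R'(1) assms(1)] by blast
  moreover have "P4_decomposition G D" if "card R' = 0"
  proof -
    \<comment> \<open>Needed because \<open>card R' = 0\<close> also holds for infinite
      sets.\<close>
    have "finite R'"
      using leave_subset[OF R'(1)] finite_edges[OF assms(1)] finite_subset by blast
    with that have "R' = {}" by simp
    with D show ?thesis
      by (simp add: P4_decomposition_with_rest_def P4_decomposition_def)
  qed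
  moreover have "card (edges G) mod 3 = 0" if "P4_decomposition G D'" for D'
    using P4_decomposition_card[OF assms(1) that] by simp
  ultimately show ?thesis by metis
qed

end
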